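(* Let $G$ be a cocomparability graph with chromatic number $3$. Then $G$ is a class-proper interval $3$-graph if and only if $G$ contains no induced subgraph isomorphic to $\overline{C_6}$, the complement of the $6$-cycle.
   Context: All graphs are finite and simple. A cocomparability graph is a graph whose complement admits a transitive orientation. A graph $G$ is an interval $k$-graph if there is a one-to-one correspondence $v\mapsto I_v$ between $V(G)$ and a family of closed intervals of the real line, together with a partition of the family into at most $k$ classes, such that distinct vertices are adjacent iff their intervals intersect and lie in different classes; it is a class-proper interval $k$-graph if it has such a representation in which no interval properly contains another interval of the same class. *)

theory Defs
  imports Complex_Main "HOL-Library.Disjoint_Sets"
begin

text \<open>
  A graph is given by a vertex set \<open>V\<close> and a symmetric, irreflexive adjacency
  relation \<open>E\<close>; an edge \<open>uv\<close> appears in \<open>E\<close> as both \<open>(u, v)\<close> and \<open>(v, u)\<close>.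
\<close>

definition finite_simple_graph :: "'a set \<Rightarrow> 'a rel \<Rightarrow> bool" where
  "finite_simple_graph V E \<longleftrightarrow> finite V \<and> E \<subseteq> V \<times> V \<and> sym E \<and> irrefl E"

definition complement_edges :: "'a set \<Rightarrow> 'a rel \<Rightarrow> 'a rel" where
  "complement_edges V E = {(u, v). u \<in> V \<and> v \<in> V \<and> u \<noteq> v \<and> (u, v) \<notin> E}"

definition orientation :: "'a rel \<Rightarrow> 'a rel \<Rightarrow> bool" where
  "orientation E D \<longleftrightarrow> D \<union> D\<inverse> = E \<and> D \<inter> D\<inverse> = {}"

definition comparability_graph :: "'a set \<Rightarrow> 'a rel \<Rightarrow> bool" where
  "comparability_graph V E \<longleftrightarrow>
     finite_simple_graph V E \<and> (\<exists>D. orientation E D \<and> trans D)"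

definition cocomparability_graph :: "'a set \<Rightarrow> 'a rel \<Rightarrow> bool" where
  "cocomparability_graph V E \<longleftrightarrow>
     finite_simple_graph V E \<and> comparability_graph V (complement_edges V E)"

definition proper_coloring :: "'a set \<Rightarrow> 'a rel \<Rightarrow> nat \<Rightarrow> ('a \<Rightarrow> nat) \<Rightarrow> bool" where
  "proper_coloring V E k c \<longleftrightarrow> c ` V \<subseteq> {..<k} \<and> (\<forall>(u, v) \<in> E. c u \<noteq> c v)"

definition chromatic_number :: "'a set \<Rightarrow> 'a rel \<Rightarrow> nat" where
  "chromatic_number V E = (LEAST k. \<exists>c. proper_coloring V E k c)"

definition graph_isomorphic :: "'a set \<Rightarrow> 'a rel \<Rightarrow> 'b set \<Rightarrow> 'b rel \<Rightarrow> bool" where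
  "graph_isomorphic V E W F \<longleftrightarrow>
     (\<exists>f. bij_betw f V W \<and> (\<forall>u\<in>V. \<forall>v\<in>V. (u, v) \<in> E \<longleftrightarrow> (f u, f v) \<in> F))"

definition has_induced_subgraph :: "'a set \<Rightarrow> 'a rel \<Rightarrow> 'b set \<Rightarrow> 'b rel \<Rightarrow> bool" where
  "has_induced_subgraph V E W F \<longleftrightarrow>
     (\<exists>U \<subseteq> V. graph_isomorphic U (E \<inter> U \<times> U) W F)"

text \<open>The cycle \<open>C\<^sub>n\<close> on the vertex set \<open>{..<n}\<close>, for \<open>n \<ge> 3\<close>.\<close>

definition cycle_edges :: "nat \<Rightarrow> nat rel" where
  "cycle_edges n =
     {(i, j). i < n \<and> j < n \<and> (j = (i + 1) mod n \<or> i = (j + 1) mod n)}"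

definition closed_interval :: "real set \<Rightarrow> bool" where
  "closed_interval S \<longleftrightarrow> (\<exists>a b. a \<le> b \<and> S = {a..b})"

text \<open>
  \<open>I\<close> maps the vertices bijectively onto the family \<open>I ` V\<close> of intervals, and the
  members of \<open>P\<close> are the classes of intervals.  Since \<open>partition_on\<close> demands nonempty
  classes, ``at most \<open>k\<close> classes'' is \<open>card P \<le> k\<close>.
\<close>

definition interval_k_representation ::
  "nat \<Rightarrow> 'a set \<Rightarrow> 'a rel \<Rightarrow> ('a \<Rightarrow> real set) \<Rightarrow> real set set set \<Rightarrow> bool" where
  "interval_k_representation k V E I P \<longleftrightarrow>
     inj_on I V \<and> (\<forall>v\<in>V. closed_interval (I v)) \<and>
     partition_on (I ` V) P \<and> card P \<le> k \<and>
     (\<forall>u\<in>V. \<forall>v\<in>V. u \<noteq> v \<longrightarrow>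
        ((u, v) \<in> E \<longleftrightarrow> I u \<inter> I v \<noteq> {} \<and> \<not> (\<exists>C\<in>P. I u \<in> C \<and> I v \<in> C)))"

definition interval_k_graph :: "nat \<Rightarrow> 'a set \<Rightarrow> 'a rel \<Rightarrow> bool" where
  "interval_k_graph k V E \<longleftrightarrow>
     finite_simple_graph V E \<and> (\<exists>I P. interval_k_representation k V E I P)"

definition class_proper_interval_k_graph :: "nat \<Rightarrow> 'a set \<Rightarrow> 'a rel \<Rightarrow> bool" where
  "class_proper_interval_k_graph k V E \<longleftrightarrow>
     finite_simple_graph V E \<and>
     (\<exists>I P. interval_k_representation k V E I P \<and>
            (\<forall>C\<in>P. \<forall>S\<in>C. \<forall>T\<in>C. \<not> S \<subset> T))"

end

theory Submission
  imports Defs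
begin

text \<open>
  For the interesting direction, let \<open><\<close> be a transitive orientation of the complement and fix any
  proper 3-colouring, so that colour classes are chains. A class-proper representation in which
  \<open>x < y\<close> with distinct colours forces \<open>x\<close> to lie to the left of \<open>y\<close> is a system of inequalities
  between endpoints, which is solvable unless some closed walk alternates between steps \<open>x < y\<close> with
  distinct colours and steps between incomparable or equal elements. Walks can be
  shortened: \<open>x < y\<close>, \<open>y \<parallel> z\<close>, \<open>z < w\<close> gives \<open>x < w\<close>, since \<open>x \<parallel> w\<close> would need four colours; and a
  walk with three order steps that admits no shortening closes up to the crown whose comparability
  graph is \<open>C\<^sub>6\<close>.
\<close>

section \<open>Induced prisms (complements of the 6-cycle) obstruct interval 3-graphs\<close>

lemma has_induced_subgraph_iff_embedding:
  "has_induced_subgraph V E W F \<longleftrightarrow>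
     (\<exists>g. inj_on g W \<and> g ` W \<subseteq> V \<and> (\<forall>i\<in>W. \<forall>j\<in>W. (g i, g j) \<in> E \<longleftrightarrow> (i, j) \<in> F))"
    (is "?L \<longleftrightarrow> ?R")
proof
  assume ?L
  then obtain U f where U: "U \<subseteq> V" and f: "bij_betw f U W"
    and e: "\<And>u v. u \<in> U \<Longrightarrow> v \<in> U \<Longrightarrow> (u, v) \<in> E \<longleftrightarrow> (f u, f v) \<in> F"
    unfolding has_induced_subgraph_def graph_isomorphic_def by auto
  let ?g = "inv_into U f"
  have g: "bij_betw ?g W U" using f by (rule bij_betw_inv_into)
  have "(?g i, ?g j) \<in> E \<longleftrightarrow> (i, j) \<in> F" if "i \<in> W" "j \<in> W" for i j
    using e[of "?g i" "?g j"] that bij_betw_apply[OF g] bij_betw_inv_into_right[OF f] by simp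
  then show ?R using g U by (intro exI[of _ ?g]) (auto simp: bij_betw_def)
next
  assume ?R
  then obtain g where g: "inj_on g W" "g ` W \<subseteq> V"
    and e: "\<And>i j. i \<in> W \<Longrightarrow> j \<in> W \<Longrightarrow> (g i, g j) \<in> E \<longleftrightarrow> (i, j) \<in> F"
    by (elim exE conjE) simp
  have "bij_betw (inv_into W g) (g ` W) W"
    using g(1) by (intro bij_betw_inv_into inj_on_imp_bij_betw)
  moreover have "(g i, g j) \<in> E \<longleftrightarrow> (inv_into W g (g i), inv_into W g (g j)) \<in> F"
    if "i \<in> W" "j \<in> W" for i j
    using e that g(1) by simp
  ultimately show ?L
    unfolding has_induced_subgraph_def graph_isomorphic_def using g(2)
    by (intro exI[of _ "g ` W"]) auto
qed

lemma closed_intervals_meet_iff: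
  fixes a b c d :: real
  assumes "a \<le> b" "c \<le> d"
  shows "{a..b} \<inter> {c..d} \<noteq> {} \<longleftrightarrow> a \<le> d \<and> c \<le> b"
  using assms by simp linarith

text \<open>Each of the triangles 0, 2, 4 and 1, 3, 5 meets all three classes, so the classes pair
  even with odd vertices along a perfect matching of the 6-cycle. The other three edges of the cycle
  join different classes, hence have disjoint intervals, and this clashes with the intersections
  that the prism demands.\<close>

lemma prism_not_interval_3_graph:
  assumes fin: "finite V" and rep: "interval_k_representation 3 V E I P"
    and ind: "has_induced_subgraph V E {..<6} (complement_edges {..<6} (cycle_edges 6))"
  shows False
proof -
  obtain g where inj: "inj_on g {..<6::nat}" and gV: "g ` {..<6} \<subseteq> V"
    and adj: "\<And>i j. i < 6 \<Longrightarrow> j < 6 \<Longrightarrow>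
      (g i, g j) \<in> E \<longleftrightarrow> (i, j) \<in> complement_edges {..<6} (cycle_edges 6)"
    using ind unfolding has_induced_subgraph_iff_embedding by auto
  note R = rep[unfolded interval_k_representation_def]
  have part: "partition_on (I ` V) P" and card: "card P \<le> 3" using R by auto
  have edge: "(u, v) \<in> E \<longleftrightarrow> I u \<inter> I v \<noteq> {} \<and> \<not> (\<exists>C\<in>P. I u \<in> C \<and> I v \<in> C)"
    if "u \<in> V" "v \<in> V" "u \<noteq> v" for u v
    using R that by blast
  have "\<forall>v\<in>V. \<exists>a b. a \<le> b \<and> I v = {a..b}"
    using R unfolding closed_interval_def by blast
  then obtain l r where lr: "\<And>v. v \<in> V \<Longrightarrow> l v \<le> r v \<and> I v = {l v..r v}" by metis
  have "\<forall>v\<in>V. \<exists>C\<in>P. I v \<in> C" using part unfolding partition_on_def by blast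
  then obtain K where K: "\<And>v. v \<in> V \<Longrightarrow> K v \<in> P \<and> I v \<in> K v" by metis
  have same: "(\<exists>C\<in>P. I u \<in> C \<and> I v \<in> C) \<longleftrightarrow> K u = K v" if "u \<in> V" "v \<in> V" for u v
    using part K[OF that(1)] K[OF that(2)]
    unfolding partition_on_def disjoint_def by (metis IntI empty_iff)
  let ?k = "\<lambda>i. K (g i)" and ?l = "\<lambda>i. l (g i)" and ?r = "\<lambda>i. r (g i)"
  have gin: "g i \<in> V" if "i < 6" for i using gV that by auto
  have E: "(g i, g j) \<in> E \<longleftrightarrow> ?l i \<le> ?r j \<and> ?l j \<le> ?r i \<and> ?k i \<noteq> ?k j"
    if "i < 6" "j < 6" "i \<noteq> j" for i j
  proof -
    have "g i \<noteq> g j" using inj that by (auto dest: inj_onD)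
    from edge[OF gin[OF that(1)] gin[OF that(2)] this]
    have "(g i, g j) \<in> E \<longleftrightarrow> I (g i) \<inter> I (g j) \<noteq> {} \<and> ?k i \<noteq> ?k j"
      unfolding same[OF gin[OF that(1)] gin[OF that(2)]] .
    then show ?thesis
      using lr[OF gin[OF that(1)]] lr[OF gin[OF that(2)]]
        closed_intervals_meet_iff[of "?l i" "?r i" "?l j" "?r j"] by auto
  qed
  have e: "?l i \<le> ?r j \<and> ?l j \<le> ?r i \<and> ?k i \<noteq> ?k j"
    if "(i, j) \<in> {(0, 2), (0, 4), (2, 4), (1, 3), (1, 5), (3, 5), (0, 3), (1, 4), (2, 5)}" for i j
    using that E[of i j] adj[of i j] by (auto simp: complement_edges_def cycle_edges_def)
  have n: "?r i < ?l j \<or> ?r j < ?l i \<or> ?k i = ?k j"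
    if "(i, j) \<in> {(0, 1), (1, 2), (2, 3), (3, 4), (4, 5), (0, 5)}" for i j
    using that E[of i j] adj[of i j] by (auto simp: complement_edges_def cycle_edges_def)
  have "finite P"
    using fin part by (intro finite_elements[of "I ` V"]) auto
  then have "card {?k 0, ?k 2, ?k 4} = 3" "{?k 0, ?k 2, ?k 4} \<subseteq> P"
    using e[of 0 2] e[of 0 4] e[of 2 4] K gin by auto
  then have P: "P = {?k 0, ?k 2, ?k 4}"
    using card \<open>finite P\<close> by (metis card_seteq)
  have "?k i \<in> {?k 0, ?k 2, ?k 4}" if "i < 6" for i
    using P K gin that by blast
  then have k: "?k 1 \<in> {?k 0, ?k 2, ?k 4}" "?k 3 \<in> {?k 0, ?k 2, ?k 4}"
    "?k 5 \<in> {?k 0, ?k 2, ?k 4}"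
    by simp_all
  have meet: "?l 0 \<le> ?r 2" "?l 2 \<le> ?r 0" "?l 0 \<le> ?r 4" "?l 4 \<le> ?r 0" "?l 2 \<le> ?r 4" "?l 4 \<le> ?r 2"
    "?l 1 \<le> ?r 3" "?l 3 \<le> ?r 1" "?l 1 \<le> ?r 5" "?l 5 \<le> ?r 1" "?l 3 \<le> ?r 5" "?l 5 \<le> ?r 3"
    "?l 0 \<le> ?r 3" "?l 3 \<le> ?r 0" "?l 1 \<le> ?r 4" "?l 4 \<le> ?r 1" "?l 2 \<le> ?r 5" "?l 5 \<le> ?r 2"
    and ne: "?k 0 \<noteq> ?k 2" "?k 0 \<noteq> ?k 4" "?k 2 \<noteq> ?k 4" "?k 1 \<noteq> ?k 3" "?k 1 \<noteq> ?k 5" "?k 3 \<noteq> ?k 5"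
    "?k 0 \<noteq> ?k 3" "?k 1 \<noteq> ?k 4" "?k 2 \<noteq> ?k 5"
    by (simp_all only: e insert_iff prod.inject simp_thms)
  \<comment> \<open>The edges 03, 14, 25 forbid opposite vertices to share a class, so only the two
    cyclic pairings of the triangles remain.\<close>
  from k ne consider "?k 1 = ?k 0" "?k 3 = ?k 2" "?k 5 = ?k 4"
    | "?k 1 = ?k 2" "?k 3 = ?k 4" "?k 5 = ?k 0"
    by (metis insert_iff empty_iff)
  then show False
  proof cases
    case 1
    then have "?r 1 < ?l 2 \<or> ?r 2 < ?l 1" "?r 3 < ?l 4 \<or> ?r 4 < ?l 3" "?r 0 < ?l 5 \<or> ?r 5 < ?l 0"
      using n[of 1 2] n[of 3 4] n[of 0 5] ne by simp_all
    \<comment> \<open>Each triangle has a common point by Helly, so all three pairs are separated in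
      the same direction, say
      \<open>?r 2 < ?l 1 \<le> ?r 4 < ?l 3 \<le> ?r 0 < ?l 5 \<le> ?r 2\<close>, a cycle.\<close>
    then show False using meet by linarith
  next
    case 2
    then have "?r 0 < ?l 1 \<or> ?r 1 < ?l 0" "?r 2 < ?l 3 \<or> ?r 3 < ?l 2" "?r 4 < ?l 5 \<or> ?r 5 < ?l 4"
      using n[of 0 1] n[of 2 3] n[of 4 5] ne by simp_all
    then show False using meet by linarith
  qed
qed

section \<open>Walks in an order covered by three chains\<close>

text \<open>The order on the complement and a 3-colouring, detached from the graph. In
  \<open>crown_free\<close> three incomparable pairs determine the crown, since transitivity yields
  its other incomparabilities.\<close>

locale crown_free_three_chain_order =
  fixes V :: "'a set" and D :: "'a rel" and c :: "'a \<Rightarrow> nat"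
  assumes finite_V: "finite V"
    and D_subset: "D \<subseteq> V \<times> V"
    and D_trans: "trans D"
    and D_irrefl: "(x, x) \<notin> D"
    and colour_less: "x \<in> V \<Longrightarrow> c x < 3"
    and colour_chain: "x \<in> V \<Longrightarrow> y \<in> V \<Longrightarrow> c x = c y \<Longrightarrow> x = y \<or> (x, y) \<in> D \<or> (y, x) \<in> D"
    and crown_free: "(x1, y2) \<in> D \<Longrightarrow> (x1, y3) \<in> D \<Longrightarrow> (x2, y1) \<in> D \<Longrightarrow> (x2, y3) \<in> D \<Longrightarrow>
      (x3, y1) \<in> D \<Longrightarrow> (x3, y2) \<in> D \<Longrightarrow> (x1, y1) \<in> D \<or> (y1, x1) \<in> D \<or>
      (x2, y2) \<in> D \<or> (y2, x2) \<in> D \<or> (x3, y3) \<in> D \<or> (y3, x3) \<in> D"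
begin

abbreviation less (infix "\<lless>" 50) where "x \<lless> y \<equiv> (x, y) \<in> D"

text \<open>Reflexive on \<open>V\<close>.\<close>

definition incomp (infix "\<parallel>" 50) where
  "x \<parallel> y \<longleftrightarrow> x \<in> V \<and> y \<in> V \<and> \<not> x \<lless> y \<and> \<not> y \<lless> x"

definition cross (infix "\<lhd>" 50) where "x \<lhd> y \<longleftrightarrow> x \<lless> y \<and> c x \<noteq> c y"

text \<open>By \<open>walk_step\<close> below, this relates the two ends of every walk alternating between \<open>\<lhd>\<close> and \<open>\<parallel>\<close>
  that begins and ends with \<open>\<lhd>\<close>; so \<open>x\<close> has to be placed to the left of \<open>y\<close>.\<close>

definition walk (infix "\<leadsto>" 50) where
  "x \<leadsto> y \<longleftrightarrow> x \<lless> y \<and> (c x \<noteq> c y \<or> (\<exists>b d. x \<lhd> b \<and> b \<parallel> d \<and> d \<lhd> y))"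

lemma less_trans: "x \<lless> y \<Longrightarrow> y \<lless> z \<Longrightarrow> x \<lless> z"
  using D_trans by (rule transD)

lemma less_in: "x \<lless> y \<Longrightarrow> x \<in> V \<and> y \<in> V"
  using D_subset by auto

lemma incomp_sym: "x \<parallel> y \<Longrightarrow> y \<parallel> x"
  by (auto simp: incomp_def)

lemma incomp_refl: "x \<in> V \<Longrightarrow> x \<parallel> x"
  using D_irrefl by (auto simp: incomp_def)

text \<open>Otherwise transitivity leaves \<open>x \<lless> y\<close> and
  \<open>z \<lless> w\<close> as the only comparabilities among four distinct elements. Incomparable
  elements differ in colour as classes are chains, and these two pairs differ by
  \<open>cross\<close>.\<close>

lemma cross_incomp_cross_less:
  assumes "x \<lhd> y" "y \<parallel> z" "z \<lhd> w"
  shows "x \<lless> w"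
proof (rule ccontr)
  assume xw: "\<not> x \<lless> w"
  have less: "x \<lless> y" "z \<lless> w" and col: "c x \<noteq> c y" "c z \<noteq> c w"
    using assms by (auto simp: cross_def)
  have in_V: "x \<in> V" "y \<in> V" "z \<in> V" "w \<in> V" using less less_in by auto
  have yz: "\<not> y \<lless> z" "\<not> z \<lless> y" using assms(2) by (auto simp: incomp_def)
  have "y \<noteq> z" "x \<noteq> w" "\<not> w \<lless> x" "\<not> x \<lless> z" "\<not> z \<lless> x" "\<not> y \<lless> w" "\<not> w \<lless> y" "x \<noteq> z" "y \<noteq> w"
    using less xw yz less_trans by blast+
  then have "c y \<noteq> c z" "c x \<noteq> c w" "c x \<noteq> c z" "c y \<noteq> c w"
    using colour_chain in_V xw yz by blast+
  then show False
    using col colour_less[OF in_V(1)] colour_less[OF in_V(2)] colour_less[OF in_V(3)]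
      colour_less[OF in_V(4)] by linarith
qed

lemma cross_step:
  assumes "x \<lhd> y" "y \<parallel> z" "z \<lhd> w"
  shows "x \<leadsto> w"
  using assms cross_incomp_cross_less[OF assms] unfolding walk_def by blast

text \<open>This closes \<open>walk\<close> under extension. The critical case has three order steps
  \<open>x \<lhd> b\<close>, \<open>d \<lhd> y\<close>, \<open>z \<lhd> w\<close>: either two of
  them merge into one \<open>cross\<close> step, or the ends satisfy \<open>x \<lless> w\<close>
  with distinct colours.\<close>

lemma walk_step:
  assumes "x \<leadsto> y" "y \<parallel> z" "z \<lhd> w"
  shows "x \<leadsto> w"
proof (cases "c x = c y")
  case False
  then have "x \<lhd> y" using assms(1) by (auto simp: walk_def cross_def)
  then show ?thesis using assms cross_step by blast
next
  case True
  then obtain b d where bd: "x \<lhd> b" "b \<parallel> d" "d \<lhd> y" and xy: "x \<lless> y"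
    using assms(1) by (auto simp: walk_def)
  have dw: "d \<lless> w" using cross_incomp_cross_less[OF bd(3) assms(2,3)] .
  show ?thesis
  proof (cases "c d = c w")
    case False
    then have "d \<lhd> w" using dw by (simp add: cross_def)
    then show ?thesis using bd cross_step by blast
  next
    case d_w: True
    have "c x \<noteq> c w" using True d_w bd(3) by (simp add: cross_def)
    have "x \<lless> w"
    proof (rule ccontr)
      assume xw: "\<not> x \<lless> w"
      have wx: "\<not> w \<lless> x"
        using assms(2,3) xy less_trans unfolding incomp_def cross_def by blast
      \<comment> \<open>Now the walk closes up, and shortening it across the closing pair gives
        \<open>z \<lless> b\<close>, the last relation of a crown with lower elements
        \<open>x\<close>, \<open>d\<close>, \<open>z\<close> and upper elements \<open>w\<close>,
        \<open>b\<close>, \<open>y\<close>.\<close>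
      have "w \<parallel> x" using xw wx less_in[OF xy] less_in[OF dw] by (auto simp: incomp_def)
      then have "z \<lless> b" using cross_incomp_cross_less[OF assms(3) _ bd(1)] by blast
      then show False
        using crown_free[of x b y d w z] xy dw assms(2,3) bd xw wx
        unfolding incomp_def cross_def by blast
    qed
    then show ?thesis using \<open>c x \<noteq> c w\<close> by (simp add: walk_def)
  qed
qed

section \<open>Endpoints solving the system of inequalities\<close>

text \<open>Counting walk predecessors replaces longest path lengths, so inequalities reduce to
  inclusions of sets. Given \<open>left\<close>, the value \<open>right x\<close> is the least one
  letting \<open>x\<close> reach every interval it has to meet.\<close>

definition left :: "'a \<Rightarrow> nat" where "left y = card {x. x \<leadsto> y}"
definition right :: "'a \<Rightarrow> nat" where "right x = Max (left ` {z. x \<parallel> z})"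

text \<open>The summand \<open>c x\<close> separates vertices of different colours.\<close>

definition rank :: "'a \<Rightarrow> nat" where "rank x = 3 * card {u. u \<lless> x} + c x"

lemma finite_walk: "finite {x. x \<leadsto> y}"
  using finite_V by (rule rev_finite_subset) (auto simp: walk_def dest: less_in)

lemma finite_incomp: "finite {z. x \<parallel> z}"
  using finite_V by (rule rev_finite_subset) (auto simp: incomp_def)

lemma finite_less: "finite {u. u \<lless> x}"
  using finite_V by (rule rev_finite_subset) (auto dest: less_in)

lemma left_le_right: "x \<parallel> y \<Longrightarrow> left y \<le> right x"
  unfolding right_def using finite_incomp by (intro Max_ge) auto

lemma right_attained:
  assumes "x \<in> V"
  obtains z where "x \<parallel> z" "right x = left z"
proof -
  have "right x \<in> left ` {z. x \<parallel> z}"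
    unfolding right_def using finite_incomp incomp_refl[OF assms] by (intro Max_in) auto
  then show ?thesis using that by auto
qed

text \<open>If \<open>z\<close> attains \<open>right x\<close>, every walk into \<open>z\<close>
  extends through \<open>z \<parallel> x \<lhd> y\<close>. The inclusion of predecessors is strict
  because of \<open>x\<close> itself.\<close>

lemma right_less_left:
  assumes "x \<lhd> y"
  shows "right x < left y"
proof -
  have xV: "x \<in> V" using assms less_in by (auto simp: cross_def)
  then obtain z where z: "x \<parallel> z" "right x = left z" by (rule right_attained)
  have "{u. u \<leadsto> z} \<subseteq> {u. u \<leadsto> y}" using walk_step incomp_sym[OF z(1)] assms by blast
  moreover have "x \<leadsto> y" using assms by (auto simp: walk_def cross_def)
  moreover have "\<not> x \<leadsto> z" using z(1) by (auto simp: walk_def incomp_def)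
  ultimately have "{u. u \<leadsto> z} \<subset> {u. u \<leadsto> y}" by blast
  then show ?thesis using z(2) finite_walk unfolding left_def by (simp add: psubset_card_mono)
qed

text \<open>With equal colours, the last step of a walk into \<open>x\<close> can be redirected to
  \<open>y\<close>.\<close>

lemma left_mono:
  assumes "x \<lless> y" "c x = c y"
  shows "left x \<le> left y"
proof -
  have "u \<leadsto> y" if "u \<leadsto> x" for u
    using that assms less_trans unfolding walk_def cross_def by metis
  then show ?thesis unfolding left_def using finite_walk by (intro card_mono) auto
qed

lemma right_mono:
  assumes "x \<lless> y" "c x = c y"
  shows "right x \<le> right y"
proof -
  have V: "x \<in> V" "y \<in> V" using assms less_in by auto
  obtain z where z: "x \<parallel> z" "right x = left z" using V(1) by (rule right_attained)
  show ?thesis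
  proof (cases "y \<parallel> z")
    case True
    then show ?thesis using z(2) left_le_right by simp
  next
    case False
    have "\<not> y \<lless> z" using z(1) assms less_trans unfolding incomp_def by blast
    then have "z \<lless> y" using False V z(1) by (auto simp: incomp_def)
    moreover have "left z \<le> left y"
    proof (cases "z = x")
      case True
      then show ?thesis using left_mono assms by simp
    next
      case False
      \<comment> \<open>Hence \<open>z \<lhd> y\<close>, and
        \<open>left z \<le> right z < left y\<close>.\<close>
      then have "c z \<noteq> c x" using colour_chain z(1) unfolding incomp_def by blast
      then have "z \<lhd> y" using \<open>z \<lless> y\<close> assms by (simp add: cross_def)
      moreover have "z \<parallel> z" using z(1) incomp_refl by (auto simp: incomp_def)
      ultimately show ?thesis using right_less_left left_le_right by fastforce
    qed
    ultimately show ?thesis using z(2) left_le_right[OF incomp_refl[OF V(2)]] by simp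
  qed
qed

lemma rank_less:
  assumes "x \<lless> y" "c x = c y"
  shows "rank x < rank y"
proof -
  have "{u. u \<lless> x} \<subset> {u. u \<lless> y}" using assms less_trans D_irrefl by blast
  from psubset_card_mono[OF finite_less this] show ?thesis
    using assms(2) by (simp add: rank_def)
qed

lemma rank_inj: "inj_on rank V"
proof (rule inj_onI)
  fix x y assume xy: "x \<in> V" "y \<in> V" "rank x = rank y"
  have "rank x mod 3 = rank y mod 3" using xy by simp
  then have "c x = c y" using colour_less xy(1,2) by (simp add: rank_def)
  then show "x = y" using colour_chain[OF xy(1,2)] rank_less xy(3) by fastforce
qed

lemma rank_bound:
  assumes "x \<in> V"
  shows "rank x < 3 * card V + 3"
proof -
  have "card {u. u \<lless> x} \<le> card V" using finite_V by (intro card_mono) (auto dest: less_in)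
  then show ?thesis using colour_less[OF assms] unfolding rank_def by linarith
qed

text \<open>The intervals \<open>{left x..right x}\<close> may coincide, hence the perturbation by \<open>rank\<close>.\<close>

lemma class_proper_endpoints:
  obtains l r :: "'a \<Rightarrow> real" where "inj_on l V" "\<And>x. x \<in> V \<Longrightarrow> l x \<le> r x"
    "\<And>x y. x \<lless> y \<Longrightarrow> c x \<noteq> c y \<Longrightarrow> r x < l y"
    "\<And>x y. x \<parallel> y \<Longrightarrow> l x \<le> r y"
    "\<And>x y. x \<lless> y \<Longrightarrow> c x = c y \<Longrightarrow> l x < l y \<and> r x < r y"
proof -
  \<comment> \<open>\<open>M\<close> exceeds every rank, so \<open>rank\<close> only breaks ties.
    The odd factor in \<open>r\<close> keeps \<open>l x \<le> r y\<close> when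
    \<open>left x = right y\<close>, and \<open>right x < left y\<close> still leaves a full block
    of length \<open>M\<close> between the two endpoints.\<close>
  define M where "M = 3 * card V + 3"
  define l where "l x = M * (2 * left x) + rank x" for x
  define r where "r x = M * (2 * right x + 1) + rank x" for x
  have rank: "rank x < M" if "x \<in> V" for x using rank_bound[OF that] by (simp add: M_def)
  have lr: "l x \<le> r y" if "x \<parallel> y" for x y
  proof -
    have "M * (2 * left x) \<le> M * (2 * right y)" using left_le_right[OF incomp_sym[OF that]] by simp
    moreover have "rank x < M" using that rank by (auto simp: incomp_def)
    ultimately show ?thesis unfolding l_def r_def distrib_left by linarith
  qed
  have rl: "r x < l y" if "x \<lless> y" "c x \<noteq> c y" for x y
  proof -
    have "M * (2 * right x + 2) \<le> M * (2 * left y)"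
      using right_less_left[of x y] that by (intro mult_le_mono2) (simp add: cross_def)
    moreover have "rank x < M" using that less_in rank by blast
    ultimately show ?thesis unfolding l_def r_def distrib_left by linarith
  qed
  have mono: "l x < l y \<and> r x < r y" if "x \<lless> y" "c x = c y" for x y
    unfolding l_def r_def using rank_less[OF that] left_mono[OF that] right_mono[OF that]
    by (auto intro!: add_le_less_mono mult_le_mono2)
  have "inj_on l V"
  proof (rule inj_onI)
    fix x y assume xy: "x \<in> V" "y \<in> V" "l x = l y"
    have "l x mod M = l y mod M" using xy(3) by simp
    then have "rank x = rank y" using rank xy(1,2) by (simp add: l_def)
    then show "x = y" using rank_inj xy(1,2) by (auto dest: inj_onD)
  qed
  then show ?thesis
    using that[of "\<lambda>x. real (l x)" "\<lambda>x. real (r x)"] lr rl mono incomp_refl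
    by (auto simp: inj_on_def)
qed

end

section \<open>Passing between orders, colourings and graphs\<close>

text \<open>A relation between two lower or two upper elements would compose with a crown relation
  to compare some \<open>x_i\<close> with \<open>y_i\<close>. So the comparability graph is exactly
  a 6-cycle, and \<open>E\<close> induces its complement.\<close>

lemma crown_imp_prism:
  assumes G: "finite_simple_graph V E"
    and D: "orientation (complement_edges V E) D" "trans D"
    and crown: "(x1, y2) \<in> D" "(x1, y3) \<in> D" "(x2, y1) \<in> D" "(x2, y3) \<in> D"
      "(x3, y1) \<in> D" "(x3, y2) \<in> D"
    and inc: "(x1, y1) \<notin> D" "(y1, x1) \<notin> D" "(x2, y2) \<notin> D" "(y2, x2) \<notin> D"
      "(x3, y3) \<notin> D" "(y3, x3) \<notin> D"
  shows "has_induced_subgraph V E {..<6} (complement_edges {..<6} (cycle_edges 6))"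
proof -
  have U: "D \<union> D\<inverse> = complement_edges V E" and dis: "D \<inter> D\<inverse> = {}"
    using D(1) by (auto simp: orientation_def)
  have edge: "(u, v) \<in> E \<longleftrightarrow> u \<noteq> v \<and> (u, v) \<notin> D \<and> (v, u) \<notin> D" if "u \<in> V" "v \<in> V" for u v
  proof -
    have "(u, v) \<in> D \<or> (v, u) \<in> D \<longleftrightarrow> u \<noteq> v \<and> (u, v) \<notin> E"
      using U that unfolding complement_edges_def by blast
    moreover have "(u, u) \<notin> E" for u using G unfolding finite_simple_graph_def irrefl_def by blast
    ultimately show ?thesis by blast
  qed
  have in_V: "x1 \<in> V" "x2 \<in> V" "x3 \<in> V" "y1 \<in> V" "y2 \<in> V" "y3 \<in> V"
    using crown U unfolding complement_edges_def by blast+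
  have tr: "(u, v) \<in> D \<Longrightarrow> (v, w) \<in> D \<Longrightarrow> (u, w) \<in> D" for u v w using D(2) by (rule transD)
  have "x1 \<noteq> x2" "x1 \<noteq> x3" "x2 \<noteq> x3" "y1 \<noteq> y2" "y1 \<noteq> y3" "y2 \<noteq> y3"
    "x1 \<noteq> y1" "x2 \<noteq> y2" "x3 \<noteq> y3"
    using crown inc tr by blast+
  moreover have "x1 \<noteq> y2" "x1 \<noteq> y3" "x2 \<noteq> y1" "x2 \<noteq> y3" "x3 \<noteq> y1" "x3 \<noteq> y2"
    using crown dis by blast+
  ultimately have dist: "distinct [x1, y2, x3, y1, x2, y3]" by auto
  have anti: "(x1, x2) \<notin> D" "(x2, x1) \<notin> D" "(x1, x3) \<notin> D" "(x3, x1) \<notin> D" "(x2, x3) \<notin> D"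
    "(x3, x2) \<notin> D" "(y1, y2) \<notin> D" "(y2, y1) \<notin> D" "(y1, y3) \<notin> D" "(y3, y1) \<notin> D"
    "(y2, y3) \<notin> D" "(y3, y2) \<notin> D"
    using crown inc tr by blast+
  \<comment> \<open>The list runs once around the 6-cycle of comparabilities.\<close>
  let ?g = "nth [x1, y2, x3, y1, x2, y3]"
  have six: "{..<6::nat} = {0, 1, 2, 3, 4, 5}" by auto
  have "inj_on ?g {..<6}" using dist by (intro inj_on_nth) auto
  moreover have "?g ` {..<6} \<subseteq> V" using in_V by (auto simp: six)
  moreover have "\<forall>i\<in>{..<6}. \<forall>j\<in>{..<6}.
      (?g i, ?g j) \<in> E \<longleftrightarrow> (i, j) \<in> complement_edges {..<6} (cycle_edges 6)"
    unfolding six using dist in_V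
    by (simp add: edge complement_edges_def cycle_edges_def crown inc anti) metis
  ultimately show ?thesis unfolding has_induced_subgraph_iff_embedding by blast
qed

text \<open>Injectivity of \<open>l\<close> makes intervals distinct as sets, so colour classes turn
  into classes of intervals, and it rules out proper containment with a common left end.\<close>

lemma class_proper_interval_k_graphI:
  fixes l r :: "'a \<Rightarrow> real"
  assumes G: "finite_simple_graph V E" and col: "proper_coloring V E k c"
    and inj: "inj_on l V" and lr: "\<And>x. x \<in> V \<Longrightarrow> l x \<le> r x"
    and adj: "\<And>x y. x \<in> V \<Longrightarrow> y \<in> V \<Longrightarrow> c x \<noteq> c y \<Longrightarrow> (x, y) \<in> E \<longleftrightarrow> l x \<le> r y \<and> l y \<le> r x"
    and proper: "\<And>x y. x \<in> V \<Longrightarrow> y \<in> V \<Longrightarrow> c x = c y \<Longrightarrow> l x < l y \<Longrightarrow> r x < r y"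
  shows "class_proper_interval_k_graph k V E"
proof -
  define I where "I x = {l x..r x}" for x
  define Q where "Q i = I ` {v \<in> V. c v = i}" for i
  have I_eq: "I x = I y \<longleftrightarrow> x = y" if "x \<in> V" "y \<in> V" for x y
    using that lr[of x] lr[of y] inj by (auto simp: I_def inj_on_def)
  have Q: "I v \<in> Q i \<longleftrightarrow> c v = i" if "v \<in> V" for v i
    using that I_eq by (auto simp: Q_def)
  \<comment> \<open>Only colours that occur index a class, as \<open>partition_on\<close> demands
    nonempty classes.\<close>
  have "partition_on (I ` V) (Q ` c ` V)"
    unfolding partition_on_def disjoint_def using Q by (auto simp: Q_def I_eq)
  moreover have "card (Q ` c ` V) \<le> k"
  proof -
    have "c ` V \<subseteq> {..<k}" using col by (simp add: proper_coloring_def)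
    then have "card (c ` V) \<le> k" "finite (c ` V)"
      using card_mono[of "{..<k}"] by (auto intro: finite_subset)
    then show ?thesis using card_image_le le_trans by blast
  qed
  moreover have "(u, v) \<in> E \<longleftrightarrow>
      I u \<inter> I v \<noteq> {} \<and> \<not> (\<exists>C\<in>Q ` c ` V. I u \<in> C \<and> I v \<in> C)" if "u \<in> V" "v \<in> V" for u v
  proof -
    have "(\<exists>C\<in>Q ` c ` V. I u \<in> C \<and> I v \<in> C) \<longleftrightarrow> c u = c v" using that Q by auto
    moreover have "(u, v) \<in> E \<Longrightarrow> c u \<noteq> c v" using col by (auto simp: proper_coloring_def)
    moreover have "I u \<inter> I v \<noteq> {} \<longleftrightarrow> l u \<le> r v \<and> l v \<le> r u"
      unfolding I_def using lr that by (intro closed_intervals_meet_iff)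
    ultimately show ?thesis using adj[OF that] by blast
  qed
  moreover have "inj_on I V" using I_eq by (auto simp: inj_on_def)
  moreover have "\<forall>v\<in>V. closed_interval (I v)" using lr by (auto simp: closed_interval_def I_def)
  ultimately have "interval_k_representation k V E I (Q ` c ` V)"
    unfolding interval_k_representation_def by blast
  moreover have "\<not> S \<subset> T" if C: "C \<in> Q ` c ` V" and ST: "S \<in> C" "T \<in> C" for C S T
  proof
    assume sub: "S \<subset> T"
    from C ST obtain x y where xy: "x \<in> V" "y \<in> V" "c x = c y" and S: "S = I x" and T: "T = I y"
      by (auto simp: Q_def)
    have "l y \<le> l x" "r x \<le> r y" using sub lr[OF xy(1)] by (auto simp: S T I_def)
    moreover have "l x \<noteq> l y" using sub xy inj by (auto simp: S T inj_on_def)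
    ultimately show False using proper[of y x] xy by simp
  qed
  ultimately show ?thesis using G unfolding class_proper_interval_k_graph_def by blast
qed

text \<open>\<open>LEAST\<close> is attained because numbering the vertices injectively is a proper
  colouring.\<close>

lemma proper_coloring_chromatic_number:
  assumes G: "finite_simple_graph V E"
  obtains c where "proper_coloring V E (chromatic_number V E) c"
proof -
  have "finite V" using G by (simp add: finite_simple_graph_def)
  then obtain h where h: "bij_betw h V {0..<card V}" using ex_bij_betw_finite_nat by blast
  have "h u \<noteq> h v" if "(u, v) \<in> E" for u v
    using that G h unfolding finite_simple_graph_def irrefl_def bij_betw_def inj_on_def by blast
  then have "proper_coloring V E (card V) h"
    using h by (auto simp: proper_coloring_def bij_betw_def)
  then have "\<exists>k c. proper_coloring V E k c" by blast
  then have "\<exists>c. proper_coloring V E (chromatic_number V E) c"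
    unfolding chromatic_number_def by (rule LeastI_ex)
  then show ?thesis using that by blast
qed

theorem theorem4p3:
  fixes V :: "'a set" and E :: "'a rel"
  assumes "cocomparability_graph V E"
    and "chromatic_number V E = 3"
  shows "class_proper_interval_k_graph 3 V E \<longleftrightarrow>
    \<not> has_induced_subgraph V E {..<6} (complement_edges {..<6} (cycle_edges 6))"
proof
  assume "class_proper_interval_k_graph 3 V E"
  then obtain I P where "finite V" "interval_k_representation 3 V E I P"
    unfolding class_proper_interval_k_graph_def finite_simple_graph_def by (elim conjE exE) simp
  then show "\<not> has_induced_subgraph V E {..<6} (complement_edges {..<6} (cycle_edges 6))"
    by (intro notI) (rule prism_not_interval_3_graph)
next
  assume prism_free: "\<not> has_induced_subgraph V E {..<6} (complement_edges {..<6} (cycle_edges 6))"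
  have G: "finite_simple_graph V E" using assms(1) by (simp add: cocomparability_graph_def)
  obtain D where D: "orientation (complement_edges V E) D" "trans D"
    using assms(1) by (auto simp: cocomparability_graph_def comparability_graph_def)
  obtain c where c: "proper_coloring V E 3 c"
    using proper_coloring_chromatic_number[OF G] assms(2) by metis
  have U: "D \<union> D\<inverse> = complement_edges V E" using D(1) by (simp add: orientation_def)
  have comp: "(u, v) \<in> D \<or> (v, u) \<in> D \<longleftrightarrow> u \<noteq> v \<and> (u, v) \<notin> E" if "u \<in> V" "v \<in> V" for u v
    using U that unfolding complement_edges_def by blast
  interpret crown_free_three_chain_order V D c
  proof
    show "finite V" using G by (simp add: finite_simple_graph_def)
    have "D \<subseteq> complement_edges V E" unfolding U[symmetric] by (rule Un_upper1)
    then show "D \<subseteq> V \<times> V" by (auto simp: complement_edges_def)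
    show "trans D" by (rule D(2))
    show "(x, x) \<notin> D" for x
    proof -
      have "D \<inter> D\<inverse> = {}" using D(1) by (simp add: orientation_def)
      then show ?thesis by blast
    qed
    show "c x < 3" if "x \<in> V" for x using c that by (auto simp: proper_coloring_def)
    show "x = y \<or> (x, y) \<in> D \<or> (y, x) \<in> D" if "x \<in> V" "y \<in> V" "c x = c y" for x y
      using comp[OF that(1,2)] c that(3) by (auto simp: proper_coloring_def)
    fix x1 x2 x3 y1 y2 y3
    assume "(x1, y2) \<in> D" "(x1, y3) \<in> D" "(x2, y1) \<in> D" "(x2, y3) \<in> D"
      "(x3, y1) \<in> D" "(x3, y2) \<in> D"
    from crown_imp_prism[OF G D this] prism_free
    show "(x1, y1) \<in> D \<or> (y1, x1) \<in> D \<or> (x2, y2) \<in> D \<or> (y2, x2) \<in> D \<or>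
        (x3, y3) \<in> D \<or> (y3, x3) \<in> D"
      by argo
  qed
  obtain l r :: "'a \<Rightarrow> real" where l: "inj_on l V" and lr: "\<And>x. x \<in> V \<Longrightarrow> l x \<le> r x"
    and left: "\<And>x y. (x, y) \<in> D \<Longrightarrow> c x \<noteq> c y \<Longrightarrow> r x < l y"
    and meet: "\<And>x y. incomp x y \<Longrightarrow> l x \<le> r y"
    and mono: "\<And>x y. (x, y) \<in> D \<Longrightarrow> c x = c y \<Longrightarrow> l x < l y \<and> r x < r y"
    using that by (rule class_proper_endpoints)
  show "class_proper_interval_k_graph 3 V E"
  proof (rule class_proper_interval_k_graphI[OF G c l lr])
    fix x y assume xy: "x \<in> V" "y \<in> V"
    show "(x, y) \<in> E \<longleftrightarrow> l x \<le> r y \<and> l y \<le> r x" if col: "c x \<noteq> c y"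
    proof (cases "(x, y) \<in> E")
      case True
      then have "incomp x y" using comp[OF xy] xy by (auto simp: incomp_def)
      then show ?thesis using True meet incomp_sym by blast
    next
      case False
      then have "(x, y) \<in> D \<or> (y, x) \<in> D" using comp[OF xy] col by auto
      then show ?thesis using False left[of x y] left[of y x] col by fastforce
    qed
    \<comment> \<open>Equally coloured vertices are comparable, and \<open>l x < l y\<close>
      excludes \<open>(y, x) \<in> D\<close>.\<close>
    show "r x < r y" if "c x = c y" "l x < l y"
      using colour_chain[OF xy that(1)] mono[of x y] mono[of y x] that by fastforce
  qed
qed

end
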